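(* Let $\lambda$ be an infinite regular cardinal and let $(X,<)$ be a linearly ordered set with $|X|=\lambda$. Then $X$ has a subset whose induced order type is $\lambda$ or the reverse of $\lambda$, or $X$ has a subset whose induced order type is $\omega$ or the reverse of $\omega$ and which is $\lambda$-full in $X$.
   Context: For a linearly ordered set $X$ with $|X|=\lambda$, $Y\subseteq X$ and $y_1<y_2$ in $Y$, write $(y_1,y_2)_X=\{x\in X: y_1<x<y_2\}$. $Y$ is $\lambda$-full in $X$ on the right if for every $y\in Y$, $\left|\bigcup_{y<y'\in Y}(y,y')_X\right|=\lambda$; $Y$ is $\lambda$-full in $X$ on the left if for every $y\in Y$, $\left|\bigcup_{Y\ni y'<y}(y',y)_X\right|=\lambda$. "$\lambda$-full" means $\lambda$-full on the right or on the left (for a subset of order type $\omega$ it is on the right, for the reverse of $\omega$ on the left). *)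

theory Defs
  imports Main
begin

unbundle cardinal_syntax

text \<open>
  A linearly ordered set \<open>(X, <)\<close> is a carrier \<open>X\<close> with its reflexive order \<open>R\<close>
  (\<open>linear_order_on X R\<close>), so \<open>x < y\<close> reads \<open>(x, y) \<in> R - Id\<close>.
  A cardinal is a relation \<open>\<kappa>\<close> with \<open>Card_order \<kappa>\<close>, that is, a well-order of minimal
  length on its field; it thus serves both as a cardinality, \<open>|A| =o \<kappa>\<close>,
  and as an order type, \<open>Restr R Y =o \<kappa>\<close>.
\<close>

definition open_interval :: "'a set \<Rightarrow> 'a rel \<Rightarrow> 'a \<Rightarrow> 'a \<Rightarrow> 'a set" where
  "open_interval X R a b = {x \<in> X. (a, x) \<in> R - Id \<and> (x, b) \<in> R - Id}"

definition full_on_right :: "'b rel \<Rightarrow> 'a set \<Rightarrow> 'a rel \<Rightarrow> 'a set \<Rightarrow> bool" where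
  "full_on_right \<kappa> X R Y \<longleftrightarrow>
    (\<forall>y \<in> Y. |\<Union>y' \<in> {y' \<in> Y. (y, y') \<in> R - Id}. open_interval X R y y'| =o \<kappa>)"

definition full_on_left :: "'b rel \<Rightarrow> 'a set \<Rightarrow> 'a rel \<Rightarrow> 'a set \<Rightarrow> bool" where
  "full_on_left \<kappa> X R Y \<longleftrightarrow>
    (\<forall>y \<in> Y. |\<Union>y' \<in> {y' \<in> Y. (y', y) \<in> R - Id}. open_interval X R y' y| =o \<kappa>)"

text \<open>
  A subset of order type \<open>\<omega>\<close> is never full on the left, since nothing lies below its least
  element; dually for the reverse of \<open>\<omega>\<close>. So for these two types the side is forced.
\<close>

definition full_in :: "'b rel \<Rightarrow> 'a set \<Rightarrow> 'a rel \<Rightarrow> 'a set \<Rightarrow> bool" where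
  "full_in \<kappa> X R Y \<longleftrightarrow> full_on_right \<kappa> X R Y \<or> full_on_left \<kappa> X R Y"

text \<open>
  \<open>=o\<close> is isomorphism of well-orders, so having the reverse of a well-order type is
  expressed by comparing the converse of the induced order.
\<close>

definition has_order_type :: "'a rel \<Rightarrow> 'a set \<Rightarrow> 'b rel \<Rightarrow> bool" where
  "has_order_type R Y r \<longleftrightarrow> Restr R Y =o r"

definition has_reverse_order_type :: "'a rel \<Rightarrow> 'a set \<Rightarrow> 'b rel \<Rightarrow> bool" where
  "has_reverse_order_type R Y r \<longleftrightarrow> (Restr R Y)\<inverse> =o r"

end

theory Submission
  imports Defs
begin

text \<open>
  Call a subset of \<open>X\<close> large if it has \<open>\<kappa>\<close> elements. If every large set can be cut at
  a point into two large pieces, repeatedly cutting the lower piece gives a decreasing sequence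
  whose consecutive terms bound large intervals, hence a full subset of type reverse \<open>\<omega>\<close>.
  Otherwise some large set cannot be cut, and splits into the points below which it is small and the
  points above which it is small; one of the two parts is large. If it is the first one, regularity
  makes its cofinality \<open>\<kappa>\<close>, so it contains a copy of \<open>\<kappa>\<close>; dually for the second one.
\<close>

text \<open>An arbitrary well-order \<open>r\<close> of \<open>L\<close> is available by choice.
  Keeping only the elements that are \<open>R\<close>-above everything enumerated earlier makes
  \<open>R\<close> inherit well-foundedness from \<open>r\<close> without losing cofinality.\<close>

lemma cofinal_well_ordered_subset:
  assumes R: "linear_order_on X R" and "L \<subseteq> X"
  obtains Y where "Y \<subseteq> L" "well_order_on Y (Restr R Y)" "\<And>x. x \<in> L \<Longrightarrow> \<exists>y\<in>Y. (x, y) \<in> R"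
proof -
  obtain r where r: "well_order_on L r"
    using card_of_well_order_on by blast
  \<comment> \<open>the record values of the enumeration \<open>r\<close>; on them the two orders agree\<close>
  define Y where "Y = {y \<in> L. \<forall>z\<in>L. (z, y) \<in> r \<longrightarrow> (z, y) \<in> R}"
  have lin: "linear_order_on L r" and wf: "wf (r - Id)"
    using r by (auto simp: well_order_on_def)
  have F: "Field r = L"
    using r well_order_on_Field by blast
  have reflR: "\<And>x. x \<in> X \<Longrightarrow> (x, x) \<in> R" and antiR: "antisym R" and transR: "trans R"
    using R by (auto simp: order_on_defs refl_on_def)
  have totR: "\<And>x y. \<lbrakk>x \<in> X; y \<in> X\<rbrakk> \<Longrightarrow> (x, y) \<in> R \<or> (y, x) \<in> R"
    using R unfolding order_on_defs refl_on_def total_on_def by metis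
  have totr: "\<And>x y. \<lbrakk>x \<in> L; y \<in> L\<rbrakk> \<Longrightarrow> (x, y) \<in> r \<or> (y, x) \<in> r"
    using lin unfolding order_on_defs refl_on_def total_on_def by metis
  have YL: "Y \<subseteq> L"
    by (auto simp: Y_def)
  have agree: "(x, y) \<in> r \<longleftrightarrow> (x, y) \<in> R" if "x \<in> Y" "y \<in> Y" for x y
  proof
    show "(x, y) \<in> r \<Longrightarrow> (x, y) \<in> R"
      using that by (auto simp: Y_def)
    assume "(x, y) \<in> R"
    \<comment> \<open>If the enumeration had \<open>y\<close> before \<open>x\<close>, then
      \<open>x\<close> being a record would give \<open>(y, x) \<in> R\<close>, so
      \<open>x = y\<close> by antisymmetry.\<close>
    moreover have "(y, x) \<in> r \<Longrightarrow> (y, x) \<in> R"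
      using that by (auto simp: Y_def)
    ultimately show "(x, y) \<in> r"
      using that YL totr[of x y] antiR by (metis antisymD subsetD)
  qed
  then have eq: "Restr R Y = Restr r Y"
    by blast
  have "Field (Restr r Y) = Y"
    using YL totr by (fastforce simp: Field_def)
  then have "well_order_on Y (Restr R Y)"
    using Well_order_Restr[of r Y] r F eq by simp
  moreover have "\<exists>y\<in>Y. (x, y) \<in> R" if "x \<in> L" for x
  proof -
    let ?Q = "{z \<in> L. (x, z) \<in> R}"
    have "x \<in> ?Q"
      using that reflR \<open>L \<subseteq> X\<close> by auto
    with wf obtain a where a: "a \<in> ?Q" "\<And>z. (z, a) \<in> r - Id \<Longrightarrow> z \<notin> ?Q"
      by (rule wfE_min) blast
    \<comment> \<open>The \<open>r\<close>-first element \<open>a\<close> that is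
      \<open>R\<close>-above \<open>x\<close> is a record: whatever is enumerated earlier lies
      \<open>R\<close>-below \<open>x\<close>, hence below \<open>a\<close>.\<close>
    have "(z, a) \<in> R" if z: "z \<in> L" "(z, a) \<in> r" for z
    proof (cases "z = a")
      case True
      then show ?thesis using reflR z \<open>L \<subseteq> X\<close> by auto
    next
      case False
      then have "(x, z) \<notin> R"
        using a(2)[of z] z by auto
      then have "(z, x) \<in> R"
        using totR[of x z] \<open>x \<in> L\<close> z \<open>L \<subseteq> X\<close> by auto
      then show ?thesis
        using a(1) transR by (auto dest: transD)
    qed
    then have "a \<in> Y"
      using a(1) by (auto simp: Y_def)
    then show ?thesis
      using a(1) by auto
  qed
  ultimately show ?thesis
    using that YL by blast
qed

text \<open>A well-ordered cofinal \<open>Y\<close> has the right type. If \<open>Y\<close> were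
  small, \<open>L\<close> would be a union of fewer than \<kappa> small initial segments, against
  regularity. If \<open>Y\<close> were longer than \<kappa>, one of its proper initial segments
  would already have \<kappa> elements, against \<open>small\<close>.\<close>

lemma regular_order_type_subset:
  assumes \<kappa>: "Card_order \<kappa>" "cinfinite \<kappa>" "regularCard \<kappa>"
    and R: "linear_order_on X R" and "L \<subseteq> X" and L: "|L| =o \<kappa>"
    and small: "\<And>x. x \<in> L \<Longrightarrow> |{z \<in> L. (z, x) \<in> R}| <o \<kappa>"
  shows "\<exists>Y\<subseteq>L. has_order_type R Y \<kappa>"
proof -
  obtain Y where YL: "Y \<subseteq> L" and wo: "well_order_on Y (Restr R Y)"
    and cof: "\<And>x. x \<in> L \<Longrightarrow> \<exists>y\<in>Y. (x, y) \<in> R"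
    using cofinal_well_ordered_subset[OF R \<open>L \<subseteq> X\<close>] by blast
  have F: "Field (Restr R Y) = Y"
    using wo well_order_on_Field by blast
  have WO: "Well_order (Restr R Y)" and W\<kappa>: "Well_order \<kappa>"
    using wo F \<kappa>(1) by (auto simp: card_order_on_def)
  have "\<not> |Y| <o \<kappa>"
  proof
    assume "|Y| <o \<kappa>"
    moreover have "stable \<kappa>"
      using \<kappa> by (simp add: regularCard_stable cinfinite_def)
    ultimately have "|\<Union>y\<in>Y. {z \<in> L. (z, y) \<in> R}| <o \<kappa>"
      using small YL by (intro stable_UNION) auto
    moreover have "L \<subseteq> (\<Union>y\<in>Y. {z \<in> L. (z, y) \<in> R})"
      using cof by blast
    ultimately have "|L| <o \<kappa>"
      using card_of_mono1 ordLeq_ordLess_trans by blast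
    then show False
      using L not_ordLess_ordIso by blast
  qed
  then have "\<kappa> \<le>o |Y|"
    using not_ordLess_iff_ordLeq[OF W\<kappa> card_of_Well_order] by blast
  also have "|Y| \<le>o Restr R Y"
    using wo by (rule card_of_least)
  finally have "\<kappa> \<le>o Restr R Y" .
  moreover have "\<not> \<kappa> <o Restr R Y"
  proof
    assume "\<kappa> <o Restr R Y"
    then obtain a where a: "a \<in> Y" "\<kappa> =o Restr (Restr R Y) (underS (Restr R Y) a)" (is "_ =o ?S")
      using ordLess_iff_ordIso_Restr[OF WO W\<kappa>] F by auto
    have "|Field \<kappa>| =o |Field ?S|"
      using a(2) by (rule card_of_cong)
    moreover have "|Field ?S| \<le>o |{z \<in> L. (z, a) \<in> R}|"
      using YL by (intro card_of_mono1) (auto simp: Field_def underS_def)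
    ultimately have "|Field \<kappa>| <o \<kappa>"
      using small[of a] a(1) YL ordIso_ordLeq_trans ordLeq_ordLess_trans by blast
    then show False
      using card_of_Field_ordIso[OF \<kappa>(1)] not_ordLess_ordIso by blast
  qed
  ultimately have "Restr R Y =o \<kappa>"
    using not_ordLess_iff_ordLeq[OF WO W\<kappa>] ordIso_iff_ordLeq by blast
  then show ?thesis
    using YL by (auto simp: has_order_type_def)
qed

lemma decreasing_sequence_order_type:
  fixes s :: "nat \<Rightarrow> 'a"
  assumes R: "linear_order_on X R" and X: "\<And>n. s n \<in> X"
    and dec: "\<And>m n. m < n \<Longrightarrow> (s n, s m) \<in> R - Id"
  shows "has_reverse_order_type R (range s) natLeq"
proof -
  have refl: "\<And>x. x \<in> X \<Longrightarrow> (x, x) \<in> R" and anti: "antisym R"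
    using R by (auto simp: order_on_defs refl_on_def)
  have iff: "(s n, s m) \<in> R \<longleftrightarrow> m \<le> n" for m n
    using dec[of m n] dec[of n m] refl[OF X, of m] anti
    by (cases m n rule: linorder_cases) (auto dest: antisymD)
  have "inj s"
    by (rule injI) (metis iff order_antisym order_refl)
  moreover have "(Restr R (range s))\<inverse> = dir_image natLeq s"
    by (auto simp: dir_image_def natLeq_def iff) blast
  ultimately show ?thesis
    using dir_image_ordIso[of natLeq s] natLeq_Well_order
    by (simp add: has_reverse_order_type_def Field_natLeq ordIso_symmetric)
qed

text \<open>Closed intervals and weak descent are what repeated cutting delivers, since the cut
  point belongs to both pieces. Strict descent follows: equal neighbours would bound an interval of
  at most one point, which is small because \<kappa> is infinite.\<close>

lemma full_reverse_omega_subset: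
  fixes s :: "nat \<Rightarrow> 'a"
  assumes \<kappa>: "Card_order \<kappa>" "cinfinite \<kappa>"
    and R: "linear_order_on X R" and X: "|X| =o \<kappa>"
    and sX: "\<And>n. s n \<in> X" and step: "\<And>n. (s (Suc n), s n) \<in> R"
    and large: "\<And>n. \<not> |{z \<in> X. (s (Suc n), z) \<in> R \<and> (z, s n) \<in> R}| <o \<kappa>"
  shows "\<exists>Y\<subseteq>X. has_reverse_order_type R Y natLeq \<and> full_in \<kappa> X R Y"
proof -
  have anti: "antisym R" and trans: "trans R"
    using R by (auto simp: order_on_defs)
  have fin: "|A| <o \<kappa>" if "finite A" for A :: "'a set"
    using finite_ordLess_infinite[OF card_of_Well_order, of \<kappa> A] that \<kappa>
    by (simp add: cinfinite_def card_order_on_def Field_card_of)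
  have ne: "s (Suc n) \<noteq> s n" for n
  proof
    assume "s (Suc n) = s n"
    then have "{z \<in> X. (s (Suc n), z) \<in> R \<and> (z, s n) \<in> R} \<subseteq> {s n}"
      using anti by (auto dest: antisymD)
    then have "finite {z \<in> X. (s (Suc n), z) \<in> R \<and> (z, s n) \<in> R}"
      by (rule finite_subset) simp
    from fin[OF this] show False
      using large[of n] by simp
  qed
  have strict: "trans (R - Id)"
    using anti trans by (simp add: trans_diff_Id)
  have dec: "(s n, s m) \<in> R - Id" if "m < n" for m n
    using that
  proof (induction rule: strict_inc_induct)
    case (base i)
    then show ?case using step[of i] ne[of i] by auto
  next
    case (step i)
    then show ?case
      using \<open>(s (Suc i), s i) \<in> R\<close> ne[of i] strict by (auto dest: transD)
  qed
  have "|\<Union>y'\<in>{y' \<in> range s. (y', s n) \<in> R - Id}. open_interval X R y' (s n)| =o \<kappa>"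
    (is "|?U| =o \<kappa>") for n
  proof -
    \<comment> \<open>shifting by one step on either side turns the closed interval into an open one\<close>
    have "{z \<in> X. (s (Suc (Suc n)), z) \<in> R \<and> (z, s (Suc n)) \<in> R}
        \<subseteq> open_interval X R (s (Suc (Suc (Suc n)))) (s n)"
    proof
      fix z
      assume z: "z \<in> {z \<in> X. (s (Suc (Suc n)), z) \<in> R \<and> (z, s (Suc n)) \<in> R}"
      have "(s (Suc (Suc (Suc n))), z) \<in> R - Id"
        using z dec[of "Suc (Suc n)" "Suc (Suc (Suc n))"] anti trans
        by (auto dest: transD antisymD)
      moreover have "(z, s n) \<in> R - Id"
        using z dec[of n "Suc n"] anti trans by (auto dest: transD antisymD)
      ultimately show "z \<in> open_interval X R (s (Suc (Suc (Suc n)))) (s n)"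
        using z by (auto simp: open_interval_def)
    qed
    also have "\<dots> \<subseteq> ?U"
      using dec[of n "Suc (Suc (Suc n))"] by (intro UN_upper) simp
    finally have "|{z \<in> X. (s (Suc (Suc n)), z) \<in> R \<and> (z, s (Suc n)) \<in> R}| \<le>o |?U|"
      by (rule card_of_mono1)
    from ordLeq_ordLess_trans[OF this] have "\<not> |?U| <o \<kappa>"
      by (rule contrapos_nn[OF large])
    moreover have "|?U| \<le>o \<kappa>"
      by (intro ordLeq_ordIso_trans[OF card_of_mono1 X]) (auto simp: open_interval_def)
    ultimately show ?thesis
      by (simp add: ordLeq_iff_ordLess_or_ordIso)
  qed
  then have "full_in \<kappa> X R (range s)"
    by (auto simp: full_in_def full_on_left_def)
  moreover have "has_reverse_order_type R (range s) natLeq"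
    using R sX dec by (rule decreasing_sequence_order_type)
  ultimately show ?thesis
    using sX by blast
qed

theorem theorem2p2:
  fixes \<kappa> :: "'b rel" and X :: "'a set" and R :: "'a rel"
  assumes "Card_order \<kappa>" and "cinfinite \<kappa>" and "regularCard \<kappa>"
    and "linear_order_on X R"
    and "|X| =o \<kappa>"
  shows "(\<exists>Y \<subseteq> X. has_order_type R Y \<kappa> \<or> has_reverse_order_type R Y \<kappa>) \<or>
    (\<exists>Y \<subseteq> X. (has_order_type R Y natLeq \<or> has_reverse_order_type R Y natLeq) \<and>
      full_in \<kappa> X R Y)"
proof (cases "\<exists>C\<subseteq>X. \<not> |C| <o \<kappa> \<and>
    (\<forall>x\<in>C. |{z \<in> C. (z, x) \<in> R}| <o \<kappa> \<or> |{z \<in> C. (x, z) \<in> R}| <o \<kappa>)")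
  case True
  then obtain C where C: "C \<subseteq> X" "\<not> |C| <o \<kappa>"
    and uncut: "\<And>x. x \<in> C \<Longrightarrow> |{z \<in> C. (z, x) \<in> R}| <o \<kappa> \<or> |{z \<in> C. (x, z) \<in> R}| <o \<kappa>"
    by blast
  \<comment> \<open>A large set is not the union of two small ones, as \<kappa> is infinite, so
    \<open>L\<close> or \<open>U\<close> is large. Smallness of segments passes from
    \<open>C\<close> to either part.\<close>
  define L where "L = {x \<in> C. |{z \<in> C. (z, x) \<in> R}| <o \<kappa>}"
  define U where "U = {x \<in> C. |{z \<in> C. (x, z) \<in> R}| <o \<kappa>}"
  have sub: "L \<subseteq> C" "U \<subseteq> C" and "C = L \<union> U"
    using uncut by (auto simp: L_def U_def)
  have LU: "\<not> |L| <o \<kappa> \<or> \<not> |U| <o \<kappa>"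
    using C(2) assms(1,2) card_of_Un_ordLess_infinite_Field[of \<kappa> L U] \<open>C = L \<union> U\<close>
    by (auto simp: cinfinite_def)
  have large: "|A| =o \<kappa>" if "A \<subseteq> C" "\<not> |A| <o \<kappa>" for A
    using that C(1) ordLeq_ordIso_trans[OF card_of_mono1 assms(5)] ordLeq_iff_ordLess_or_ordIso
    by (metis subset_trans)
  have small: "|{z \<in> A. P z}| <o \<kappa>" if "A \<subseteq> C" "|{z \<in> C. P z}| <o \<kappa>" for A P
    using that by (intro ordLeq_ordLess_trans[OF card_of_mono1 that(2)]) auto
  from LU consider "|L| =o \<kappa>" | "|U| =o \<kappa>"
    using large[OF sub(1)] large[OF sub(2)] by blast
  then show ?thesis
  proof cases
    case 1
    obtain Y where Y: "Y \<subseteq> L" "has_order_type R Y \<kappa>"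
      using 1 sub C(1) small[OF sub(1)]
        regular_order_type_subset[OF assms(1-4), of L] by (auto simp: L_def)
    then have "Y \<subseteq> X"
      using sub C(1) by simp
    with Y(2) show ?thesis
      by (intro disjI1 exI[of _ Y]) simp
  next
    case 2
    \<comment> \<open>Reversing the order turns the final segments of \<open>U\<close> into initial
      segments, so the same lemma applies.\<close>
    have "linear_order_on X (R\<inverse>)"
      using assms(4) by simp
    then obtain Y where Y: "Y \<subseteq> U" "has_order_type (R\<inverse>) Y \<kappa>"
      using 2 sub C(1) small[OF sub(2)]
        regular_order_type_subset[OF assms(1-3), of X "R\<inverse>" U] by (auto simp: U_def)
    then have "Y \<subseteq> X"
      using sub C(1) by simp
    moreover have "Restr (R\<inverse>) Y = (Restr R Y)\<inverse>"
      by blast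
    then have "has_reverse_order_type R Y \<kappa>"
      using Y(2) by (simp add: has_order_type_def has_reverse_order_type_def)
    ultimately show ?thesis
      by (intro disjI1 exI[of _ Y]) simp
  qed
next
  case False
  then have cut: "\<exists>x\<in>C. \<not> |{z \<in> C. (z, x) \<in> R}| <o \<kappa> \<and> \<not> |{z \<in> C. (x, z) \<in> R}| <o \<kappa>"
    if "C \<subseteq> X" "\<not> |C| <o \<kappa>" for C
    using that by blast
  have trans: "trans R"
    using assms(4) by (auto simp: order_on_defs)
  \<comment> \<open>\<open>P\<close> is the invariant of the recursion: the segment up to
    \<open>x\<close> is large, so it can be cut again. \<open>Q\<close> records that the upper
    piece, left behind between \<open>y\<close> and \<open>x\<close>, is large. Cutting
    \<open>X\<close> itself supplies a first point.\<close>
  define P where "P x \<longleftrightarrow> x \<in> X \<and> \<not> |{z \<in> X. (z, x) \<in> R}| <o \<kappa>" for x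
  define Q where "Q x y \<longleftrightarrow> (y, x) \<in> R \<and> \<not> |{z \<in> X. (y, z) \<in> R \<and> (z, x) \<in> R}| <o \<kappa>" for x y
  have "\<exists>x. P x"
    using cut[of X] assms(5) not_ordLess_ordIso by (auto simp: P_def)
  moreover have "\<exists>y. P y \<and> Q x y" if x: "P x" for x
  proof -
    let ?C = "{z \<in> X. (z, x) \<in> R}"
    obtain y where y: "y \<in> ?C" "\<not> |{z \<in> ?C. (z, y) \<in> R}| <o \<kappa>" "\<not> |{z \<in> ?C. (y, z) \<in> R}| <o \<kappa>"
      using cut[of ?C] x by (auto simp: P_def)
    \<comment> \<open>By transitivity the lower piece is again a full initial segment of
      \<open>X\<close>, so the recursion need only remember the cut point.\<close>
    have "{z \<in> ?C. (z, y) \<in> R} = {z \<in> X. (z, y) \<in> R}"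
      using y(1) trans by (auto dest: transD)
    moreover have "{z \<in> ?C. (y, z) \<in> R} = {z \<in> X. (y, z) \<in> R \<and> (z, x) \<in> R}"
      by blast
    ultimately show ?thesis
      using y by (auto simp: P_def Q_def)
  qed
  ultimately obtain s where "\<And>n. P (s n)" "\<And>n. Q (s n) (s (Suc n))"
    using dependent_nat_choice[of "\<lambda>_. P" "\<lambda>_. Q"] by auto
  then have "\<exists>Y\<subseteq>X. has_reverse_order_type R Y natLeq \<and> full_in \<kappa> X R Y"
    using assms by (intro full_reverse_omega_subset[where s = s]) (auto simp: P_def Q_def)
  then show ?thesis
    by blast
qed

end
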